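(* Let $\mathcal G$ be a non-empty ample groupoid and $\Gamma$ its inverse semigroup of compact local bisections. Then: (1) $\mathcal G$ is effective if and only if $\Gamma$ is fundamental; (2) $\mathcal G$ is minimal if and only if $\Gamma$ is additively $0$-simple; (3) $\mathcal G$ is topologically free if and only if $\Gamma$ is quasi-fundamental.
   Context: A groupoid $\mathcal G$ is identified with its set of arrows; $\mathcal G^0\subseteq\mathcal G$ is the set of identities (unit space), $d,r$ are the domain and range maps, and $\alpha\beta$ is defined when $d(\alpha)=r(\beta)$. A topological groupoid is étale if $d$ is a local homeomorphism; $\mathcal G^0$ is always assumed locally compact Hausdorff, but $\mathcal G$ need not be Hausdorff. It is ample if moreover $\mathcal G^0$ has a basis of compact open sets. A local bisection is an open $U\subseteq\mathcal G$ such that $d|_U$, $r|_U$ are homeomorphisms onto their images. The set $\Gamma$ of compact local bisections is an inverse semigroup under $UV=\{uv:u\in U,v\in V,d(u)=r(v)\}$ with $U^*=\{u^{-1}:u\in U\}$, zero $\emptyset$, idempotents the compact open subsets of $\mathcal G^0$, and natural partial order given by inclusion. It is a Boolean inverse semigroup: $E(\Gamma)$ is a (not necessarily unital) Boolean algebra, compatible elements have joins (given by union), and products distribute over joins. $\mathcal G$ is effective if the interior of $\mathrm{Iso}(\mathcal G)=\{g:d(g)=r(g)\}$ equals $\mathcal G^0$; topologically free if $\mathrm{Iso}(\mathcal G)\setminus\mathcal G^0$ has empty interior; minimal if every orbit $\{r(g):d(g)=x\}$, $x\in\mathcal G^0$, is dense in $\mathcal G^0$ (equivalently, $\mathcal G^0$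 has no proper non-empty open invariant subset, invariant meaning a union of orbits). For an inverse semigroup $S$, $Z_S(E(S))$ is the centralizer of the idempotents. $S$ is fundamental if $Z_S(E(S))=E(S)$; $S$ with zero is quasi-fundamental if every non-zero $s\in Z_S(E(S))$ satisfies $e\le s$ for some $0\neq e\in E(S)$. An ideal of $S$ is a non-empty $I\subseteq S$ with $SI\cup IS\subseteq I$; an ideal $I$ of a Boolean inverse semigroup is additive if $e,f\in I\cap E(S)$ and $ef=0$ imply $e\vee f\in I$. A non-zero Boolean inverse semigroup is additively $0$-simple if its only additive ideals are $\{0\}$ and itself. *)

theory Defs
  imports "HOL-Analysis.Analysis"
begin

section \<open>Topological groupoids\<close>

text \<open>
  A groupoid is identified with its set of arrows, here the underlying set of the topology
  \<open>gtop G\<close>. All operations are total functions, constrained only on arrows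
  (\<open>gmult G a b\<close> only when \<open>gdom G a = grng G b\<close>).
\<close>

record 'a topological_groupoid_data =
  gtop :: "'a topology"
  gdom :: "'a \<Rightarrow> 'a"
  grng :: "'a \<Rightarrow> 'a"
  gmult :: "'a \<Rightarrow> 'a \<Rightarrow> 'a"
  ginv :: "'a \<Rightarrow> 'a"

definition arrows :: "('a, 'm) topological_groupoid_data_scheme \<Rightarrow> 'a set" where
  "arrows G = topspace (gtop G)"

definition units :: "('a, 'm) topological_groupoid_data_scheme \<Rightarrow> 'a set" where
  "units G = gdom G ` arrows G"

definition unit_top :: "('a, 'm) topological_groupoid_data_scheme \<Rightarrow> 'a topology" where
  "unit_top G = subtopology (gtop G) (units G)"

definition composable :: "('a, 'm) topological_groupoid_data_scheme \<Rightarrow> ('a \<times> 'a) set" where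
  "composable G = {(a, b). a \<in> arrows G \<and> b \<in> arrows G \<and> gdom G a = grng G b}"

locale groupoid =
  fixes G :: "('a, 'm) topological_groupoid_data_scheme"
  assumes dom_closed: "a \<in> arrows G \<Longrightarrow> gdom G a \<in> arrows G"
    and rng_closed: "a \<in> arrows G \<Longrightarrow> grng G a \<in> arrows G"
    and dom_dom: "a \<in> arrows G \<Longrightarrow> gdom G (gdom G a) = gdom G a"
    and rng_dom: "a \<in> arrows G \<Longrightarrow> grng G (gdom G a) = gdom G a"
    and dom_rng: "a \<in> arrows G \<Longrightarrow> gdom G (grng G a) = grng G a"
    and rng_rng: "a \<in> arrows G \<Longrightarrow> grng G (grng G a) = grng G a"
    and mult_closed: "(a, b) \<in> composable G \<Longrightarrow> gmult G a b \<in> arrows G"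
    and dom_mult: "(a, b) \<in> composable G \<Longrightarrow> gdom G (gmult G a b) = gdom G b"
    and rng_mult: "(a, b) \<in> composable G \<Longrightarrow> grng G (gmult G a b) = grng G a"
    and mult_assoc: "(a, b) \<in> composable G \<Longrightarrow> (b, c) \<in> composable G \<Longrightarrow>
          gmult G (gmult G a b) c = gmult G a (gmult G b c)"
    and mult_dom: "a \<in> arrows G \<Longrightarrow> gmult G a (gdom G a) = a"
    and rng_mult_self: "a \<in> arrows G \<Longrightarrow> gmult G (grng G a) a = a"
    and inv_closed: "a \<in> arrows G \<Longrightarrow> ginv G a \<in> arrows G"
    and dom_inv: "a \<in> arrows G \<Longrightarrow> gdom G (ginv G a) = grng G a"
    and rng_inv: "a \<in> arrows G \<Longrightarrow> grng G (ginv G a) = gdom G a"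
    and mult_inv: "a \<in> arrows G \<Longrightarrow> gmult G a (ginv G a) = grng G a"
    and inv_mult: "a \<in> arrows G \<Longrightarrow> gmult G (ginv G a) a = gdom G a"

locale topological_groupoid = groupoid G
  for G :: "('a, 'm) topological_groupoid_data_scheme" +
  assumes continuous_mult:
      "continuous_map (subtopology (prod_topology (gtop G) (gtop G)) (composable G)) (gtop G)
         (\<lambda>(a, b). gmult G a b)"
    and continuous_inv: "continuous_map (gtop G) (gtop G) (ginv G)"

definition local_homeomorphism :: "'a topology \<Rightarrow> 'b topology \<Rightarrow> ('a \<Rightarrow> 'b) \<Rightarrow> bool" where
  "local_homeomorphism X Y f \<longleftrightarrow>
     (\<forall>x \<in> topspace X. \<exists>U. openin X U \<and> x \<in> U \<and> openin Y (f ` U) \<and>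
        homeomorphic_map (subtopology X U) (subtopology Y (f ` U)) f)"

locale etale_groupoid = topological_groupoid G
  for G :: "('a, 'm) topological_groupoid_data_scheme" +
  assumes dom_local_homeomorphism: "local_homeomorphism (gtop G) (unit_top G) (gdom G)"
    and units_locally_compact: "locally_compact_space (unit_top G)"
    and units_Hausdorff: "Hausdorff_space (unit_top G)"

locale ample_groupoid = etale_groupoid G
  for G :: "('a, 'm) topological_groupoid_data_scheme" +
  assumes units_basis: "openin (unit_top G) =
      arbitrary union_of (\<lambda>U. openin (unit_top G) U \<and> compactin (unit_top G) U)"

definition isotropy :: "('a, 'm) topological_groupoid_data_scheme \<Rightarrow> 'a set" where
  "isotropy G = {g \<in> arrows G. gdom G g = grng G g}"

definition effective :: "('a, 'm) topological_groupoid_data_scheme \<Rightarrow> bool" where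
  "effective G \<longleftrightarrow> gtop G interior_of isotropy G = units G"

definition topologically_free :: "('a, 'm) topological_groupoid_data_scheme \<Rightarrow> bool" where
  "topologically_free G \<longleftrightarrow> gtop G interior_of (isotropy G - units G) = {}"

definition orbit :: "('a, 'm) topological_groupoid_data_scheme \<Rightarrow> 'a \<Rightarrow> 'a set" where
  "orbit G x = {grng G g | g. g \<in> arrows G \<and> gdom G g = x}"

definition minimal_groupoid :: "('a, 'm) topological_groupoid_data_scheme \<Rightarrow> bool" where
  "minimal_groupoid G \<longleftrightarrow> (\<forall>x \<in> units G. unit_top G closure_of orbit G x = units G)"


section \<open>Inverse semigroups with zero\<close>

record 'b inverse_semigroup_data =
  elems :: "'b set"
  smult :: "'b \<Rightarrow> 'b \<Rightarrow> 'b"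
  star :: "'b \<Rightarrow> 'b"
  szero :: 'b

definition idempotents :: "('b, 'm) inverse_semigroup_data_scheme \<Rightarrow> 'b set" where
  "idempotents S = {e \<in> elems S. smult S e e = e}"

definition natural_le :: "('b, 'm) inverse_semigroup_data_scheme \<Rightarrow> 'b \<Rightarrow> 'b \<Rightarrow> bool" where
  "natural_le S s t \<longleftrightarrow> s \<in> elems S \<and> t \<in> elems S \<and> (\<exists>e \<in> idempotents S. s = smult S t e)"

text \<open>\<open>j\<close> is the join (least upper bound) of \<open>s\<close> and \<open>t\<close> in the natural partial order.\<close>

definition is_join :: "('b, 'm) inverse_semigroup_data_scheme \<Rightarrow> 'b \<Rightarrow> 'b \<Rightarrow> 'b \<Rightarrow> bool" where
  "is_join S s t j \<longleftrightarrow> natural_le S s j \<and> natural_le S t j \<and>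
     (\<forall>u. natural_le S s u \<and> natural_le S t u \<longrightarrow> natural_le S j u)"

definition compatible :: "('b, 'm) inverse_semigroup_data_scheme \<Rightarrow> 'b \<Rightarrow> 'b \<Rightarrow> bool" where
  "compatible S s t \<longleftrightarrow>
     smult S (star S s) t \<in> idempotents S \<and> smult S s (star S t) \<in> idempotents S"

locale inverse_semigroup_with_zero =
  fixes S :: "('b, 'm) inverse_semigroup_data_scheme"
  assumes smult_closed: "s \<in> elems S \<Longrightarrow> t \<in> elems S \<Longrightarrow> smult S s t \<in> elems S"
    and smult_assoc: "s \<in> elems S \<Longrightarrow> t \<in> elems S \<Longrightarrow> u \<in> elems S \<Longrightarrow>
          smult S (smult S s t) u = smult S s (smult S t u)"
    and star_closed: "s \<in> elems S \<Longrightarrow> star S s \<in> elems S"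
    and smult_star_smult: "s \<in> elems S \<Longrightarrow> smult S (smult S s (star S s)) s = s"
    and star_smult_star: "s \<in> elems S \<Longrightarrow> smult S (smult S (star S s) s) (star S s) = star S s"
    and star_unique: "s \<in> elems S \<Longrightarrow> t \<in> elems S \<Longrightarrow> smult S (smult S s t) s = s \<Longrightarrow>
          smult S (smult S t s) t = t \<Longrightarrow> t = star S s"
    and zero_closed: "szero S \<in> elems S"
    and zero_smult: "s \<in> elems S \<Longrightarrow> smult S (szero S) s = szero S"
    and smult_zero: "s \<in> elems S \<Longrightarrow> smult S s (szero S) = szero S"

text \<open>
  Idempotents are pairwise compatible, so the join axiom gives binary joins of idempotents
  (idempotent by distributivity), and with the product as meet the distributive law in
  \<open>idempotents S\<close> is an instance of distributivity of the product. Relative complements are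
  then all that is left to say that \<open>idempotents S\<close> is a (not necessarily unital) Boolean algebra.
\<close>

locale boolean_inverse_semigroup = inverse_semigroup_with_zero S
  for S :: "('b, 'm) inverse_semigroup_data_scheme" +
  assumes relative_complement: "e \<in> idempotents S \<Longrightarrow> f \<in> idempotents S \<Longrightarrow> natural_le S e f \<Longrightarrow>
          \<exists>g \<in> idempotents S. smult S e g = szero S \<and> is_join S e g f"
    and join_exists: "s \<in> elems S \<Longrightarrow> t \<in> elems S \<Longrightarrow> compatible S s t \<Longrightarrow> \<exists>j. is_join S s t j"
    and smult_join_left: "s \<in> elems S \<Longrightarrow> t \<in> elems S \<Longrightarrow> u \<in> elems S \<Longrightarrow> compatible S s t \<Longrightarrow>
          is_join S s t j \<Longrightarrow> is_join S (smult S u s) (smult S u t) (smult S u j)"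
    and smult_join_right: "s \<in> elems S \<Longrightarrow> t \<in> elems S \<Longrightarrow> u \<in> elems S \<Longrightarrow> compatible S s t \<Longrightarrow>
          is_join S s t j \<Longrightarrow> is_join S (smult S s u) (smult S t u) (smult S j u)"

definition idempotent_centralizer :: "('b, 'm) inverse_semigroup_data_scheme \<Rightarrow> 'b set" where
  "idempotent_centralizer S =
     {s \<in> elems S. \<forall>e \<in> idempotents S. smult S s e = smult S e s}"

definition fundamental :: "('b, 'm) inverse_semigroup_data_scheme \<Rightarrow> bool" where
  "fundamental S \<longleftrightarrow> idempotent_centralizer S = idempotents S"

definition quasi_fundamental :: "('b, 'm) inverse_semigroup_data_scheme \<Rightarrow> bool" where
  "quasi_fundamental S \<longleftrightarrow>
     (\<forall>s \<in> idempotent_centralizer S. s \<noteq> szero S \<longrightarrow>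
        (\<exists>e \<in> idempotents S. e \<noteq> szero S \<and> natural_le S e s))"

definition semigroup_ideal :: "('b, 'm) inverse_semigroup_data_scheme \<Rightarrow> 'b set \<Rightarrow> bool" where
  "semigroup_ideal S I \<longleftrightarrow> I \<noteq> {} \<and> I \<subseteq> elems S \<and>
     (\<forall>s \<in> elems S. \<forall>a \<in> I. smult S s a \<in> I \<and> smult S a s \<in> I)"

definition additive_ideal :: "('b, 'm) inverse_semigroup_data_scheme \<Rightarrow> 'b set \<Rightarrow> bool" where
  "additive_ideal S I \<longleftrightarrow> semigroup_ideal S I \<and>
     (\<forall>e \<in> I \<inter> idempotents S. \<forall>f \<in> I \<inter> idempotents S.
        smult S e f = szero S \<longrightarrow> (\<exists>j \<in> I. is_join S e f j))"

definition additively_0_simple :: "('b, 'm) inverse_semigroup_data_scheme \<Rightarrow> bool" where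
  "additively_0_simple S \<longleftrightarrow> elems S \<noteq> {szero S} \<and>
     (\<forall>I. additive_ideal S I \<longrightarrow> I = {szero S} \<or> I = elems S)"


section \<open>Compact local bisections\<close>

definition local_bisection :: "('a, 'm) topological_groupoid_data_scheme \<Rightarrow> 'a set \<Rightarrow> bool" where
  "local_bisection G U \<longleftrightarrow> openin (gtop G) U \<and>
     embedding_map (subtopology (gtop G) U) (unit_top G) (gdom G) \<and>
     embedding_map (subtopology (gtop G) U) (unit_top G) (grng G)"

definition compact_bisections ::
  "('a, 'm) topological_groupoid_data_scheme \<Rightarrow> 'a set inverse_semigroup_data" where
  "compact_bisections G =
     \<lparr> elems = {U. local_bisection G U \<and> compactin (gtop G) U},
       smult = (\<lambda>U V. {gmult G u v | u v. u \<in> U \<and> v \<in> V \<and> gdom G u = grng G v}),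
       star = (\<lambda>U. ginv G ` U),
       szero = {} \<rparr>"


text \<open>The compact local bisections of an ample groupoid form a Boolean inverse semigroup.\<close>

context groupoid
begin

lemma unit_iff: "x \<in> units G \<longleftrightarrow> x \<in> arrows G \<and> gdom G x = x"
  using dom_closed dom_dom by (auto simp: units_def image_iff) metis

lemma unit_iff_rng: "x \<in> units G \<longleftrightarrow> x \<in> arrows G \<and> grng G x = x"
  by (metis unit_iff rng_dom dom_rng)

lemma units_subset: "units G \<subseteq> arrows G"
  by (auto simp: unit_iff)

lemma dom_units: "a \<in> arrows G \<Longrightarrow> gdom G a \<in> units G"
  by (auto simp: units_def)

lemma rng_units: "a \<in> arrows G \<Longrightarrow> grng G a \<in> units G"
  by (simp add: dom_rng rng_closed unit_iff)

lemma composableI: "a \<in> arrows G \<Longrightarrow> b \<in> arrows G \<Longrightarrow> gdom G a = grng G b \<Longrightarrow> (a, b) \<in> composable G"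
  by (simp add: composable_def)

lemma cancel_inv_left:
  assumes "a \<in> arrows G" "b \<in> arrows G" "gdom G a = grng G b"
  shows "gmult G (ginv G a) (gmult G a b) = b"
  by (metis assms composableI dom_inv inv_closed inv_mult mult_assoc rng_mult_self)

lemma cancel_inv_right:
  assumes "a \<in> arrows G" "b \<in> arrows G" "grng G a = grng G b"
  shows "gmult G a (gmult G (ginv G a) b) = b"
  by (metis assms composableI dom_inv inv_closed mult_assoc mult_inv rng_inv rng_mult_self)

lemma inv_unique:
  assumes "a \<in> arrows G" "b \<in> arrows G" "gdom G a = grng G b" "gmult G a b \<in> units G"
  shows "b = ginv G a"
proof -
  have "gmult G a b = grng G a"
    using assms by (metis composableI rng_mult unit_iff_rng)
  then have "b = gmult G (ginv G a) (grng G a)"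
    using assms cancel_inv_left by metis
  then show ?thesis
    using assms by (metis dom_inv inv_closed mult_dom)
qed

lemma inv_inv: "a \<in> arrows G \<Longrightarrow> ginv G (ginv G a) = a"
  by (metis dom_inv dom_units inv_closed inv_mult inv_unique)

end

context topological_groupoid
begin

lemma continuous_mult_pair:
  assumes "continuous_map X (gtop G) f" "continuous_map X (gtop G) g"
    and "\<And>x. x \<in> topspace X \<Longrightarrow> gdom G (f x) = grng G (g x)"
  shows "continuous_map X (gtop G) (\<lambda>x. gmult G (f x) (g x))"
proof -
  have "continuous_map X (subtopology (prod_topology (gtop G) (gtop G)) (composable G))
          (\<lambda>x. (f x, g x))"
    unfolding continuous_map_in_subtopology continuous_map_paired
    using assms continuous_map_image_subset_topspace[OF assms(1)]
      continuous_map_image_subset_topspace[OF assms(2)]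
    by (auto simp: composable_def arrows_def)
  from continuous_map_compose[OF this continuous_mult] show ?thesis
    by (simp add: o_def)
qed

lemma continuous_dom: "continuous_map (gtop G) (gtop G) (gdom G)"
proof (rule continuous_map_eq)
  show "continuous_map (gtop G) (gtop G) (\<lambda>x. gmult G (ginv G x) x)"
    by (rule continuous_mult_pair) (auto simp: continuous_inv dom_inv arrows_def)
qed (simp add: inv_mult arrows_def)

lemma continuous_rng: "continuous_map (gtop G) (gtop G) (grng G)"
proof (rule continuous_map_eq)
  show "continuous_map (gtop G) (gtop G) (\<lambda>x. gmult G x (ginv G x))"
    by (rule continuous_mult_pair) (auto simp: continuous_inv rng_inv arrows_def)
qed (simp add: mult_inv arrows_def)

lemma topspace_unit_top: "topspace (unit_top G) = units G"
  using units_subset by (auto simp: unit_top_def arrows_def)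

lemma continuous_dom_units: "continuous_map (gtop G) (unit_top G) (gdom G)"
  using continuous_dom dom_units by (auto simp: unit_top_def continuous_map_in_subtopology arrows_def)

lemma continuous_rng_units: "continuous_map (gtop G) (unit_top G) (grng G)"
  using continuous_rng rng_units by (auto simp: unit_top_def continuous_map_in_subtopology arrows_def)

lemma homeomorphic_inv: "homeomorphic_maps (gtop G) (gtop G) (ginv G) (ginv G)"
  using continuous_inv inv_inv by (auto simp: homeomorphic_maps_def arrows_def)

lemma open_map_inv: "open_map (gtop G) (gtop G) (ginv G)"
  using homeomorphic_inv homeomorphic_imp_open_map homeomorphic_maps_map by blast

end

context etale_groupoid
begin

lemma open_map_dom: "open_map (gtop G) (unit_top G) (gdom G)"
  unfolding open_map_def
proof (intro allI impI)
  fix W assume W: "openin (gtop G) W"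
  show "openin (unit_top G) (gdom G ` W)"
  proof (subst openin_subopen, clarify)
    fix x assume x: "x \<in> W"
    with W have "x \<in> topspace (gtop G)" using openin_subset by blast
    then obtain U where U: "openin (gtop G) U" "x \<in> U" "openin (unit_top G) (gdom G ` U)"
      "homeomorphic_map (subtopology (gtop G) U) (subtopology (unit_top G) (gdom G ` U)) (gdom G)"
      using dom_local_homeomorphism unfolding local_homeomorphism_def by meson
    have "openin (subtopology (gtop G) U) (U \<inter> W)"
      using W by (simp add: openin_subtopology_Int2)
    then have "openin (subtopology (unit_top G) (gdom G ` U)) (gdom G ` (U \<inter> W))"
      using U(4) homeomorphic_imp_open_map open_map_def by blast
    then have "openin (unit_top G) (gdom G ` (U \<inter> W))"
      using U(3) openin_trans_full by blast
    then show "\<exists>T. openin (unit_top G) T \<and> gdom G x \<in> T \<and> T \<subseteq> gdom G ` W"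
      using x U(2) by blast
  qed
qed

lemma open_map_rng: "open_map (gtop G) (unit_top G) (grng G)"
proof -
  have "open_map (gtop G) (unit_top G) (gdom G \<circ> ginv G)"
    using open_map_inv open_map_dom open_map_compose by blast
  then show ?thesis
    by (rule open_map_eq) (simp add: dom_inv arrows_def)
qed

lemma local_bisection_iff:
  "local_bisection G U \<longleftrightarrow> openin (gtop G) U \<and> inj_on (gdom G) U \<and> inj_on (grng G) U"
proof -
  have emb: "embedding_map (subtopology (gtop G) U) (unit_top G) f \<longleftrightarrow> inj_on f U"
    if U: "openin (gtop G) U" and f: "continuous_map (gtop G) (unit_top G) f"
      "open_map (gtop G) (unit_top G) f" for f
  proof
    have T: "topspace (subtopology (gtop G) U) = U"
      using U openin_subset by fastforce
    show "inj_on f U" if "embedding_map (subtopology (gtop G) U) (unit_top G) f"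
      using that T unfolding embedding_map_def homeomorphic_map_def by simp
    assume inj: "inj_on f U"
    show "embedding_map (subtopology (gtop G) U) (unit_top G) f"
    proof (rule injective_open_imp_embedding_map)
      show "continuous_map (subtopology (gtop G) U) (unit_top G) f"
        using f(1) continuous_map_from_subtopology by blast
      show "open_map (subtopology (gtop G) U) (unit_top G) f"
        using f(2) U open_map_def openin_trans_full by metis
      show "inj_on f (topspace (subtopology (gtop G) U))"
        using inj T by simp
    qed
  qed
  show ?thesis
    using emb[OF _ continuous_dom_units open_map_dom] emb[OF _ continuous_rng_units open_map_rng]
    unfolding local_bisection_def by blast
qed

lemma openin_units: "openin (gtop G) (units G)"
proof (subst openin_subopen, clarify)
  fix x assume x: "x \<in> units G"
  then have "x \<in> topspace (gtop G)" using units_subset by (auto simp: arrows_def)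
  then obtain U where U: "openin (gtop G) U" "x \<in> U"
    "homeomorphic_map (subtopology (gtop G) U) (subtopology (unit_top G) (gdom G ` U)) (gdom G)"
    using dom_local_homeomorphism unfolding local_homeomorphism_def by meson
  have inj: "inj_on (gdom G) U"
    using U(1,3) unfolding homeomorphic_map_def
    by (metis openin_subset topspace_subtopology_subset)
  let ?W = "{g \<in> topspace (gtop G). gdom G g \<in> U} \<inter> U"
  have "openin (gtop G) ?W"
    using U(1) continuous_dom openin_continuous_map_preimage by blast
  moreover have "x \<in> ?W" using x U(2) \<open>x \<in> topspace (gtop G)\<close> by (simp add: unit_iff)
  moreover have "?W \<subseteq> units G"
    using inj by (auto simp: unit_iff arrows_def dom_dom inj_on_def)
  ultimately show "\<exists>T. openin (gtop G) T \<and> x \<in> T \<and> T \<subseteq> units G" by blast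
qed

abbreviation "\<Gamma> \<equiv> elems (compact_bisections G)"
abbreviation "prd \<equiv> smult (compact_bisections G)"

lemma Gamma_iff: "U \<in> \<Gamma> \<longleftrightarrow> openin (gtop G) U \<and> inj_on (gdom G) U \<and> inj_on (grng G) U
     \<and> compactin (gtop G) U"
  by (auto simp: compact_bisections_def local_bisection_iff)

lemma Gamma_subset: "U \<in> \<Gamma> \<Longrightarrow> U \<subseteq> arrows G"
  by (simp add: Gamma_iff arrows_def openin_subset)

lemma prd_def: "prd U V = {gmult G u v | u v. u \<in> U \<and> v \<in> V \<and> gdom G u = grng G v}"
  by (simp add: compact_bisections_def)

lemma star_def: "star (compact_bisections G) U = ginv G ` U"
  by (simp add: compact_bisections_def)

lemma szero_def: "szero (compact_bisections G) = {}"
  by (simp add: compact_bisections_def)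

lemma prdI: "u \<in> U \<Longrightarrow> v \<in> V \<Longrightarrow> gdom G u = grng G v \<Longrightarrow> gmult G u v \<in> prd U V"
  unfolding prd_def by blast

lemma prd_inj:
  assumes "U \<in> \<Gamma>" "V \<in> \<Gamma>"
  shows "inj_on (gdom G) (prd U V) \<and> inj_on (grng G) (prd U V)"
proof -
  have U: "U \<subseteq> arrows G" "inj_on (gdom G) U" "inj_on (grng G) U"
    and V: "V \<subseteq> arrows G" "inj_on (gdom G) V" "inj_on (grng G) V"
    using assms Gamma_subset Gamma_iff by auto
  have *: "gdom G (gmult G u v) = gdom G v" "grng G (gmult G u v) = grng G u"
    if "u \<in> U" "v \<in> V" "gdom G u = grng G v" for u v
    using that U(1) V(1) by (auto intro!: dom_mult rng_mult composableI)
  have "gmult G u v = gmult G u' v'"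
    if "u \<in> U" "v \<in> V" "gdom G u = grng G v" "u' \<in> U" "v' \<in> V" "gdom G u' = grng G v'"
      "gdom G (gmult G u v) = gdom G (gmult G u' v') \<or> grng G (gmult G u v) = grng G (gmult G u' v')"
    for u v u' v'
    using that U(2,3) V(2,3) * unfolding inj_on_def by metis
  then show ?thesis
    unfolding prd_def inj_on_def by blast
qed

lemma section_of_bisection:
  assumes U: "openin (gtop G) U" and inj: "inj_on f U"
    and f: "continuous_map (gtop G) (unit_top G) f" "open_map (gtop G) (unit_top G) f"
  obtains s where "continuous_map (subtopology (unit_top G) (f ` U)) (gtop G) s"
    and "\<And>u. u \<in> U \<Longrightarrow> s (f u) = u"
proof -
  have T: "topspace (subtopology (gtop G) U) = U"
    using U openin_subset by fastforce
  have "embedding_map (subtopology (gtop G) U) (unit_top G) f"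
  proof (rule injective_open_imp_embedding_map)
    show "continuous_map (subtopology (gtop G) U) (unit_top G) f"
      using f(1) continuous_map_from_subtopology by blast
    show "open_map (subtopology (gtop G) U) (unit_top G) f"
      using f(2) U open_map_def openin_trans_full by metis
    show "inj_on f (topspace (subtopology (gtop G) U))"
      using inj T by simp
  qed
  then obtain s where s: "homeomorphic_maps (subtopology (gtop G) U) (subtopology (unit_top G) (f ` U)) f s"
    unfolding embedding_map_def T homeomorphic_map_maps by blast
  show thesis
  proof
    show "continuous_map (subtopology (unit_top G) (f ` U)) (gtop G) s"
      using s unfolding homeomorphic_maps_def continuous_map_in_subtopology by blast
    show "s (f u) = u" if "u \<in> U" for u
      using s that unfolding homeomorphic_maps_def T by blast
  qed
qed

lemma prd_open:
  assumes "U \<in> \<Gamma>" "V \<in> \<Gamma>"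
  shows "openin (gtop G) (prd U V)"
proof -
  have U: "U \<subseteq> arrows G" "openin (gtop G) U" "inj_on (grng G) U" and V: "V \<subseteq> arrows G" "openin (gtop G) V"
    using assms Gamma_subset Gamma_iff by auto
  obtain s where s: "continuous_map (subtopology (unit_top G) (grng G ` U)) (gtop G) s"
    "\<And>u. u \<in> U \<Longrightarrow> s (grng G u) = u"
    using section_of_bisection[OF U(2,3) continuous_rng_units open_map_rng] by blast
  define R where "R = {g \<in> topspace (gtop G). grng G g \<in> grng G ` U}"
  have R: "openin (gtop G) R"
  proof -
    have "openin (unit_top G) (grng G ` U)"
      using U(2) open_map_rng unfolding open_map_def by blast
    then show ?thesis
      unfolding R_def by (rule openin_continuous_map_preimage[OF continuous_rng_units])
  qed
  have TR: "topspace (subtopology (gtop G) R) = R"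
    using R openin_subset by fastforce
  have c1: "continuous_map (subtopology (gtop G) R) (subtopology (unit_top G) (grng G ` U)) (grng G)"
    using continuous_map_from_subtopology[OF continuous_rng_units]
    by (auto simp: continuous_map_in_subtopology R_def)
  have c2: "continuous_map (subtopology (gtop G) R) (gtop G) (\<lambda>g. ginv G (s (grng G g)))"
    using continuous_map_compose[OF continuous_map_compose[OF c1 s(1)] continuous_inv]
    by (simp add: o_def)
  have sR: "s (grng G g) \<in> U \<and> grng G (s (grng G g)) = grng G g" if "g \<in> R" for g
    using that s(2) unfolding R_def by force
  define h where "h g = gmult G (ginv G (s (grng G g))) g" for g
  have c3: "continuous_map (subtopology (gtop G) R) (gtop G) h"
    unfolding h_def
  proof (rule continuous_mult_pair[OF c2])
    show "continuous_map (subtopology (gtop G) R) (gtop G) (\<lambda>x. x)"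
      using continuous_map_from_subtopology[OF continuous_map_id] by (simp add: id_def)
    show "gdom G (ginv G (s (grng G x))) = grng G x" if "x \<in> topspace (subtopology (gtop G) R)" for x
      using sR that U(1) dom_inv TR by fastforce
  qed
  have "openin (subtopology (gtop G) R) {g \<in> topspace (subtopology (gtop G) R). h g \<in> V}"
    using openin_continuous_map_preimage[OF c3 V(2)] .
  then have "openin (gtop G) {g \<in> R. h g \<in> V}"
    using R TR openin_trans_full by metis
  moreover have "prd U V = {g \<in> R. h g \<in> V}"
  proof (intro equalityI subsetI)
    fix g assume "g \<in> prd U V"
    then obtain u v where uv: "g = gmult G u v" "u \<in> U" "v \<in> V" "gdom G u = grng G v"
      unfolding prd_def by blast
    then have a: "u \<in> arrows G" "v \<in> arrows G" using U V by auto
    have "g \<in> arrows G" "grng G g = grng G u"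
      using uv a by (simp_all add: mult_closed rng_mult composableI)
    then have "g \<in> R" "h g = v"
      using uv a s(2) cancel_inv_left by (auto simp: R_def h_def arrows_def)
    then show "g \<in> {g \<in> R. h g \<in> V}" using uv by simp
  next
    fix g assume g: "g \<in> {g \<in> R. h g \<in> V}"
    let ?u = "s (grng G g)"
    have u: "?u \<in> U" "grng G ?u = grng G g" "?u \<in> arrows G" "g \<in> arrows G"
      using sR g U(1) by (auto simp: R_def arrows_def)
    have "gmult G ?u (h g) = g"
      unfolding h_def using u cancel_inv_right by blast
    moreover have "gdom G ?u = grng G (h g)"
      unfolding h_def using u by (simp add: composableI dom_inv inv_closed rng_inv rng_mult)
    ultimately show "g \<in> prd U V"
      using prdI[of ?u U "h g" V] u g by simp
  qed
  ultimately show ?thesis by simp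
qed

lemma prd_compact:
  assumes "U \<in> \<Gamma>" "V \<in> \<Gamma>"
  shows "compactin (gtop G) (prd U V)"
proof -
  have U: "U \<subseteq> arrows G" "openin (gtop G) U" "inj_on (gdom G) U" "compactin (gtop G) U"
    and V: "V \<subseteq> arrows G" "openin (gtop G) V" "inj_on (grng G) V" "compactin (gtop G) V"
    using assms Gamma_subset Gamma_iff by auto
  obtain s where s: "continuous_map (subtopology (unit_top G) (gdom G ` U)) (gtop G) s"
    "\<And>u. u \<in> U \<Longrightarrow> s (gdom G u) = u"
    using section_of_bisection[OF U(2,3) continuous_dom_units open_map_dom] by blast
  obtain t where t: "continuous_map (subtopology (unit_top G) (grng G ` V)) (gtop G) t"
    "\<And>v. v \<in> V \<Longrightarrow> t (grng G v) = v"
    using section_of_bisection[OF V(2,3) continuous_rng_units open_map_rng] by blast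
  define K where "K = gdom G ` U \<inter> grng G ` V"
  have K: "compactin (unit_top G) K"
    unfolding K_def
    using compact_Int_closedin compactin_imp_closedin image_compactin units_Hausdorff
      U(4) V(4) continuous_dom_units continuous_rng_units by metis
  have TK: "topspace (subtopology (unit_top G) K) = K"
    using K compactin_subset_topspace by fastforce
  have c: "continuous_map (subtopology (unit_top G) K) (gtop G) (\<lambda>x. gmult G (s x) (t x))"
  proof (rule continuous_mult_pair)
    show "continuous_map (subtopology (unit_top G) K) (gtop G) s"
      using s(1) continuous_map_from_subtopology_mono K_def by blast
    show "continuous_map (subtopology (unit_top G) K) (gtop G) t"
      using t(1) continuous_map_from_subtopology_mono K_def by blast
    show "gdom G (s x) = grng G (t x)" if "x \<in> topspace (subtopology (unit_top G) K)" for x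
      using that TK s(2) t(2) unfolding K_def by force
  qed
  have "compactin (subtopology (unit_top G) K) K"
    using K by (simp add: compactin_subtopology)
  then have "compactin (gtop G) ((\<lambda>x. gmult G (s x) (t x)) ` K)"
    using c image_compactin by blast
  moreover have "(\<lambda>x. gmult G (s x) (t x)) ` K = prd U V"
  proof (intro equalityI subsetI)
    fix g assume "g \<in> (\<lambda>x. gmult G (s x) (t x)) ` K"
    then obtain u v where "u \<in> U" "v \<in> V" "gdom G u = grng G v"
      "g = gmult G (s (gdom G u)) (t (grng G v))"
      unfolding K_def by auto
    then show "g \<in> prd U V" using s(2)[of u] t(2)[of v] prdI[of u U v V] by metis
  next
    fix g assume "g \<in> prd U V"
    then obtain u v where uv: "g = gmult G u v" "u \<in> U" "v \<in> V" "gdom G u = grng G v"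
      unfolding prd_def by blast
    then have "gdom G u \<in> K" unfolding K_def by (metis IntI imageI)
    moreover have "g = gmult G (s (gdom G u)) (t (gdom G u))"
      using uv s(2) t(2) by metis
    ultimately show "g \<in> (\<lambda>x. gmult G (s x) (t x)) ` K" by blast
  qed
  ultimately show ?thesis by simp
qed

lemma prd_closed: "U \<in> \<Gamma> \<Longrightarrow> V \<in> \<Gamma> \<Longrightarrow> prd U V \<in> \<Gamma>"
  using prd_inj[of U V] prd_open[of U V] prd_compact[of U V] Gamma_iff[of "prd U V"] by simp

lemma star_closed_Gamma:
  assumes "U \<in> \<Gamma>" shows "ginv G ` U \<in> \<Gamma>"
proof -
  have U: "U \<subseteq> arrows G" "inj_on (gdom G) U" "inj_on (grng G) U"
    using assms Gamma_subset Gamma_iff by auto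
  have "inj_on (gdom G) (ginv G ` U)" "inj_on (grng G) (ginv G ` U)"
    using U dom_inv rng_inv by (auto simp: inj_on_def subset_iff)
  moreover have "openin (gtop G) (ginv G ` U)" "compactin (gtop G) (ginv G ` U)"
    using assms open_map_inv image_compactin[OF _ continuous_inv]
    by (simp_all add: open_map_def Gamma_iff)
  ultimately show ?thesis by (simp add: Gamma_iff)
qed

lemma prd_assoc:
  assumes "U \<subseteq> arrows G" "V \<subseteq> arrows G" "W \<subseteq> arrows G"
  shows "prd (prd U V) W = prd U (prd V W)"
proof (intro equalityI subsetI)
  fix g assume "g \<in> prd (prd U V) W"
  then obtain u v w where g: "g = gmult G (gmult G u v) w" "u \<in> U" "v \<in> V" "w \<in> W"
    "gdom G u = grng G v" "gdom G (gmult G u v) = grng G w"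
    unfolding prd_def by blast
  then have a: "(u, v) \<in> composable G" "(v, w) \<in> composable G"
    using assms by (auto simp: dom_mult composable_def subset_iff)
  then have "g = gmult G u (gmult G v w)" using g mult_assoc by simp
  moreover have "gmult G v w \<in> prd V W" using g a by (intro prdI) (simp_all add: composable_def)
  moreover have "gdom G u = grng G (gmult G v w)" using g a by (simp add: rng_mult)
  ultimately show "g \<in> prd U (prd V W)" using g(2) prdI by metis
next
  fix g assume "g \<in> prd U (prd V W)"
  then obtain u v w where g: "g = gmult G u (gmult G v w)" "u \<in> U" "v \<in> V" "w \<in> W"
    "gdom G v = grng G w" "gdom G u = grng G (gmult G v w)"
    unfolding prd_def by blast
  then have a: "(u, v) \<in> composable G" "(v, w) \<in> composable G"
    using assms by (auto simp: rng_mult composable_def subset_iff)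
  then have "g = gmult G (gmult G u v) w" using g mult_assoc by simp
  moreover have "gmult G u v \<in> prd U V" using g a by (intro prdI) (simp_all add: composable_def)
  moreover have "gdom G (gmult G u v) = grng G w" using g a by (simp add: dom_mult)
  ultimately show "g \<in> prd (prd U V) W" using g(4) prdI by metis
qed

lemma prd_unit_right:
  assumes "U \<subseteq> arrows G" "E \<subseteq> units G"
  shows "prd U E = {u \<in> U. gdom G u \<in> E}"
proof (intro equalityI subsetI)
  fix g assume "g \<in> prd U E"
  then obtain u e where g: "g = gmult G u e" "u \<in> U" "e \<in> E" "gdom G u = grng G e"
    unfolding prd_def by blast
  then have "grng G e = e" "u \<in> arrows G" using assms unit_iff_rng by blast+
  then have "g = u" "gdom G u \<in> E" using g mult_dom by metis+
  then show "g \<in> {u \<in> U. gdom G u \<in> E}" using g by simp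
next
  fix u assume u: "u \<in> {u \<in> U. gdom G u \<in> E}"
  then have "u \<in> arrows G" using assms by blast
  then show "u \<in> prd U E"
    using u prdI[of u U "gdom G u" E] mult_dom rng_dom by simp
qed

lemma prd_unit_left:
  assumes "U \<subseteq> arrows G" "E \<subseteq> units G"
  shows "prd E U = {u \<in> U. grng G u \<in> E}"
proof (intro equalityI subsetI)
  fix g assume "g \<in> prd E U"
  then obtain e u where g: "g = gmult G e u" "e \<in> E" "u \<in> U" "gdom G e = grng G u"
    unfolding prd_def by blast
  then have "gdom G e = e" "u \<in> arrows G" using assms unit_iff by blast+
  then have "g = u" "grng G u \<in> E" using g rng_mult_self by metis+
  then show "g \<in> {u \<in> U. grng G u \<in> E}" using g by simp
next
  fix u assume u: "u \<in> {u \<in> U. grng G u \<in> E}"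
  then have "u \<in> arrows G" using assms by blast
  then show "u \<in> prd E U"
    using u prdI[of "grng G u" E u U] rng_mult_self dom_rng by simp
qed

lemma prd_star_self:
  assumes "U \<in> \<Gamma>"
  shows "prd (ginv G ` U) U = gdom G ` U"
proof (intro equalityI subsetI)
  have U: "U \<subseteq> arrows G" "inj_on (grng G) U" using assms Gamma_subset Gamma_iff by blast+
  {
    fix g assume "g \<in> prd (ginv G ` U) U"
    then obtain u v where g: "g = gmult G (ginv G u) v" "u \<in> U" "v \<in> U"
      "gdom G (ginv G u) = grng G v"
      unfolding prd_def by blast
    then have "u \<in> arrows G" using U by blast
    then have "u = v" using g U(2) dom_inv inj_onD by metis
    then show "g \<in> gdom G ` U" using g inv_mult \<open>u \<in> arrows G\<close> by simp
  next
    fix x assume "x \<in> gdom G ` U"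
    then obtain u where u: "x = gdom G u" "u \<in> U" "u \<in> arrows G" using U by blast
    then show "x \<in> prd (ginv G ` U) U"
      using prdI[of "ginv G u" "ginv G ` U" u U] dom_inv inv_mult by simp
  }
qed

lemma prd_self_star:
  assumes "U \<in> \<Gamma>"
  shows "prd U (ginv G ` U) = grng G ` U"
proof (intro equalityI subsetI)
  have U: "U \<subseteq> arrows G" "inj_on (gdom G) U" using assms Gamma_subset Gamma_iff by blast+
  {
    fix g assume "g \<in> prd U (ginv G ` U)"
    then obtain u v where g: "g = gmult G u (ginv G v)" "u \<in> U" "v \<in> U"
      "gdom G u = grng G (ginv G v)"
      unfolding prd_def by blast
    then have "v \<in> arrows G" using U by blast
    then have "u = v" using g U(2) rng_inv inj_onD by metis
    then show "g \<in> grng G ` U" using g mult_inv \<open>v \<in> arrows G\<close> by simp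
  next
    fix x assume "x \<in> grng G ` U"
    then obtain u where u: "x = grng G u" "u \<in> U" "u \<in> arrows G" using U by blast
    then show "x \<in> prd U (ginv G ` U)"
      using prdI[of u U "ginv G u" "ginv G ` U"] rng_inv mult_inv by simp
  }
qed

lemma dom_image_units: "U \<in> \<Gamma> \<Longrightarrow> gdom G ` U \<subseteq> units G"
  using Gamma_subset dom_units by blast

lemma rng_image_units: "U \<in> \<Gamma> \<Longrightarrow> grng G ` U \<subseteq> units G"
  using Gamma_subset rng_units by blast

lemma idem_iff: "E \<in> idempotents (compact_bisections G) \<longleftrightarrow> E \<in> \<Gamma> \<and> E \<subseteq> units G"
proof -
  have "E \<subseteq> units G" if E: "E \<in> \<Gamma>" and ee: "prd E E = E"
  proof
    fix u assume u: "u \<in> E"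
    then obtain a b where ab: "u = gmult G a b" "a \<in> E" "b \<in> E" "gdom G a = grng G b"
      using ee unfolding prd_def by blast
    have ar: "a \<in> arrows G" "b \<in> arrows G" "u \<in> arrows G" using E Gamma_subset ab u by blast+
    then have "grng G u = grng G a" "gdom G u = gdom G b"
      using ab by (simp_all add: rng_mult dom_mult composableI)
    then have "u = a" "u = b" using E ab u by (auto simp: Gamma_iff inj_on_def)
    then show "u \<in> units G"
      using ab ar by (metis cancel_inv_left dom_units inv_mult)
  qed
  moreover have "prd E E = E" if "E \<in> \<Gamma>" "E \<subseteq> units G"
    using that Gamma_subset prd_unit_right[of E E] by (auto simp: unit_iff subset_iff)
  ultimately show ?thesis unfolding idempotents_def by blast
qed

lemma subset_Gamma:
  assumes "V \<in> \<Gamma>" "openin (gtop G) U" "compactin (gtop G) U" "U \<subseteq> V"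
  shows "U \<in> \<Gamma>"
  using assms inj_on_subset unfolding Gamma_iff by blast

lemma natural_le_iff: "natural_le (compact_bisections G) U V \<longleftrightarrow> U \<in> \<Gamma> \<and> V \<in> \<Gamma> \<and> U \<subseteq> V"
proof
  assume "natural_le (compact_bisections G) U V"
  then obtain E where E: "U \<in> \<Gamma>" "V \<in> \<Gamma>" "E \<in> idempotents (compact_bisections G)" "U = prd V E"
    unfolding natural_le_def by auto
  then have "U = {v \<in> V. gdom G v \<in> E}"
    using prd_unit_right[OF Gamma_subset] idem_iff by simp
  then show "U \<in> \<Gamma> \<and> V \<in> \<Gamma> \<and> U \<subseteq> V" using E(1,2) by auto
next
  assume UV: "U \<in> \<Gamma> \<and> V \<in> \<Gamma> \<and> U \<subseteq> V"
  have "gdom G ` U \<in> \<Gamma>"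
    using UV prd_star_self[of U] prd_closed star_closed_Gamma by metis
  then have "gdom G ` U \<in> idempotents (compact_bisections G)"
    using UV dom_image_units idem_iff by simp
  moreover have "prd V (gdom G ` U) = {u \<in> V. gdom G u \<in> gdom G ` U}"
    using UV prd_unit_right[OF Gamma_subset dom_image_units] by simp
  moreover have "{u \<in> V. gdom G u \<in> gdom G ` U} = U"
  proof -
    have "inj_on (gdom G) V" "U \<subseteq> V" using UV Gamma_iff by simp_all
    then show ?thesis using inj_on_image_mem_iff[of "gdom G" V _ U] by blast
  qed
  ultimately show "natural_le (compact_bisections G) U V"
    using UV unfolding natural_le_def by auto
qed

lemma is_join_Un:
  assumes U: "U \<in> \<Gamma>" and V: "V \<in> \<Gamma>" and UV: "U \<union> V \<in> \<Gamma>"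
  shows "is_join (compact_bisections G) U V J \<longleftrightarrow> J = U \<union> V"
proof
  assume J: "is_join (compact_bisections G) U V J"
  have "natural_le (compact_bisections G) U (U \<union> V)" "natural_le (compact_bisections G) V (U \<union> V)"
    using U V UV by (simp_all only: natural_le_iff Un_upper1 Un_upper2 simp_thms)
  then have "natural_le (compact_bisections G) U J" "natural_le (compact_bisections G) V J"
    "natural_le (compact_bisections G) J (U \<union> V)"
    using J unfolding is_join_def by blast+
  then have "U \<subseteq> J" "V \<subseteq> J" "J \<subseteq> U \<union> V"
    unfolding natural_le_iff by blast+
  then show "J = U \<union> V" by (intro equalityI Un_least)
next
  assume J: "J = U \<union> V"
  show "is_join (compact_bisections G) U V J"
    using U V UV by (auto simp only: is_join_def natural_le_iff J Un_iff subset_iff)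
qed

lemma Un_Gamma:
  assumes U: "U \<in> \<Gamma>" and V: "V \<in> \<Gamma>" and c: "compatible (compact_bisections G) U V"
  shows "U \<union> V \<in> \<Gamma>"
proof -
  have c': "prd (ginv G ` U) V \<subseteq> units G" "prd U (ginv G ` V) \<subseteq> units G"
    using c by (auto simp: compatible_def star_def idem_iff)
  have d: "u = v" if "u \<in> U" "v \<in> V" "gdom G u = gdom G v" for u v
  proof -
    have a: "u \<in> arrows G" "v \<in> arrows G" using that U V Gamma_subset by blast+
    then have "gmult G u (ginv G v) \<in> units G"
      using that c'(2) prdI[of u U "ginv G v" "ginv G ` V"] by (auto simp: rng_inv)
    then have "ginv G v = ginv G u"
      using inv_unique[of u "ginv G v"] a that by (simp add: inv_closed rng_inv)
    then show ?thesis using a inv_inv by metis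
  qed
  have r: "u = v" if "u \<in> U" "v \<in> V" "grng G u = grng G v" for u v
  proof -
    have a: "u \<in> arrows G" "v \<in> arrows G" using that U V Gamma_subset by blast+
    then have "gmult G (ginv G u) v \<in> units G"
      using that c'(1) prdI[of "ginv G u" "ginv G ` U" v V] by (auto simp: dom_inv)
    then have "v = ginv G (ginv G u)"
      using inv_unique[of "ginv G u" v] a that by (simp add: inv_closed dom_inv)
    then show ?thesis using a inv_inv by metis
  qed
  have "inj_on (gdom G) (U \<union> V)" "inj_on (grng G) (U \<union> V)"
    using U V d r unfolding Gamma_iff inj_on_def by (metis Un_iff)+
  then show ?thesis
    using U V compactin_Un openin_Un unfolding Gamma_iff by blast
qed

lemma Gamma_inverse_semigroup: "inverse_semigroup_with_zero (compact_bisections G)"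
proof
  let ?S = "compact_bisections G"
  fix U assume U: "U \<in> elems ?S"
  note ssub = Gamma_subset[OF U]
  show "star ?S U \<in> elems ?S" using U star_closed_Gamma star_def by simp
  show "smult ?S (szero ?S) U = szero ?S" "smult ?S U (szero ?S) = szero ?S"
    by (auto simp: szero_def prd_def)
  show USU: "smult ?S (smult ?S U (star ?S U)) U = U"
    using U ssub prd_self_star rng_image_units prd_unit_left[of U "grng G ` U"]
    by (auto simp: star_def)
  show "smult ?S (smult ?S (star ?S U) U) (star ?S U) = star ?S U"
    using U ssub star_closed_Gamma[OF U] prd_star_self dom_image_units
      prd_unit_left[OF Gamma_subset[OF star_closed_Gamma[OF U]], of "gdom G ` U"]
    by (auto simp: star_def rng_inv subset_iff)
  fix V assume V: "V \<in> elems ?S"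
  show "smult ?S U V \<in> elems ?S" using U V prd_closed by blast
  show "smult ?S (smult ?S U V) W = smult ?S U (smult ?S V W)" if "W \<in> elems ?S" for W
    using U V that prd_assoc Gamma_subset by blast
  assume UVU: "smult ?S (smult ?S U V) U = U" and VUV: "smult ?S (smult ?S V U) V = V"
  have key: "ginv G ` A \<subseteq> B" if A: "A \<in> \<Gamma>" and B: "B \<in> \<Gamma>" and ABA: "prd (prd A B) A = A" for A B
  proof (rule image_subsetI)
    fix u assume u: "u \<in> A"
    then obtain a b c where abc: "u = gmult G (gmult G a b) c" "a \<in> A" "b \<in> B" "c \<in> A"
      "gdom G a = grng G b" "gdom G (gmult G a b) = grng G c"
      using ABA unfolding prd_def by blast
    have ar: "a \<in> arrows G" "b \<in> arrows G" "c \<in> arrows G" "u \<in> arrows G"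
      using abc u Gamma_subset[OF A] Gamma_subset[OF B] by blast+
    have ab: "(a, b) \<in> composable G" "gmult G a b \<in> arrows G" "grng G (gmult G a b) = grng G a"
      using ar abc by (simp_all add: composableI mult_closed rng_mult)
    have "gdom G u = gdom G c" "grng G u = grng G a"
      using abc ar ab by (simp_all add: composableI rng_mult dom_mult)
    then have eq: "a = u" "c = u" using abc u A unfolding Gamma_iff by (metis inj_onD)+
    have "gmult G (gmult G a b) u = u" using abc(1) eq by simp
    have "gmult G a b = gmult G (gmult G (gmult G a b) u) (ginv G u)"
      using ab ar abc eq
      by (metis composableI inv_closed mult_assoc mult_dom mult_inv rng_inv)
    also have "\<dots> = grng G u" using \<open>gmult G (gmult G a b) u = u\<close> ar mult_inv by simp
    finally have "gmult G a b \<in> units G" using ar rng_units by simp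
    then have "b = ginv G a" using inv_unique[OF ar(1,2) abc(5)] by blast
    then show "ginv G u \<in> B" using abc(3) eq(1) by metis
  qed
  have "V \<subseteq> ginv G ` U"
  proof
    fix v assume v: "v \<in> V"
    then have "ginv G v \<in> U" using key[OF V U VUV] by blast
    then show "v \<in> ginv G ` U" using inv_inv[of v] v V Gamma_subset by (metis image_eqI subsetD)
  qed
  then show "V = star ?S U" using key[OF U V UVU] by (auto simp: star_def)
next
  show "szero (compact_bisections G) \<in> \<Gamma>" by (simp add: szero_def Gamma_iff)
qed

end

lemma (in ample_groupoid) boolean_inverse_semigroup_compact_bisections:
  "boolean_inverse_semigroup (compact_bisections G)"
proof -
  interpret S: inverse_semigroup_with_zero "compact_bisections G"
    by (rule Gamma_inverse_semigroup)
  show ?thesis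
  proof
    fix E F
    assume E: "E \<in> idempotents (compact_bisections G)" and F: "F \<in> idempotents (compact_bisections G)"
      and EF: "natural_le (compact_bisections G) E F"
    have sub: "E \<in> \<Gamma>" "F \<in> \<Gamma>" "E \<subseteq> units G" "F \<subseteq> units G" "E \<subseteq> F"
      using E F EF by (auto simp: idem_iff natural_le_iff)
    have K: "compactin (unit_top G) E" "compactin (unit_top G) F"
      using sub unfolding unit_top_def compactin_subtopology Gamma_iff by auto
    have oF: "openin (unit_top G) F"
      using sub openin_units openin_open_subtopology unfolding unit_top_def Gamma_iff by blast
    have cl: "closedin (unit_top G) E" "closedin (unit_top G) F"
      using K units_Hausdorff compactin_imp_closedin by blast+
    have "openin (unit_top G) (F - E)" using oF cl openin_diff by blast
    then have oD: "openin (gtop G) (F - E)"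
      using openin_units openin_open_subtopology unfolding unit_top_def by blast
    have oE: "openin (unit_top G) E"
      using sub openin_units openin_open_subtopology unfolding unit_top_def Gamma_iff by blast
    have "compactin (unit_top G) (F - E)"
      using K(2) cl(2) oE closedin_diff closed_compactin by (metis Diff_subset)
    then have "compactin (gtop G) (F - E)"
      unfolding unit_top_def compactin_subtopology by blast
    then have D: "F - E \<in> idempotents (compact_bisections G)"
      using oD sub subset_Gamma[of F "F - E"] by (auto simp: idem_iff)
    moreover have "prd E (F - E) = szero (compact_bisections G)"
      using prd_unit_right[of E "F - E"] sub Gamma_subset by (auto simp: szero_def unit_iff subset_iff)
    moreover have "is_join (compact_bisections G) E (F - E) F"
      using is_join_Un[of E "F - E" F] D sub by (auto simp: idem_iff Un_absorb1)
    ultimately show "\<exists>g \<in> idempotents (compact_bisections G).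
        prd E g = szero (compact_bisections G) \<and> is_join (compact_bisections G) E g F"
      by blast
  next
    fix U V assume UV: "U \<in> \<Gamma>" "V \<in> \<Gamma>" "compatible (compact_bisections G) U V"
    note Un = Un_Gamma[OF UV]
    show "\<exists>j. is_join (compact_bisections G) U V j"
      using is_join_Un UV Un by blast
    fix W J assume W: "W \<in> \<Gamma>" and J: "is_join (compact_bisections G) U V J"
    have J: "J = U \<union> V" using J is_join_Un UV Un by blast
    have 1: "prd W U \<union> prd W V = prd W J" unfolding J prd_def by blast
    have "prd W U \<union> prd W V \<in> \<Gamma>" unfolding 1 J using prd_closed[OF W Un] .
    then show "is_join (compact_bisections G) (prd W U) (prd W V) (prd W J)"
      using is_join_Un[OF prd_closed[OF W UV(1)] prd_closed[OF W UV(2)]] 1 by metis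
    have 2: "prd U W \<union> prd V W = prd J W" unfolding J prd_def by blast
    have "prd U W \<union> prd V W \<in> \<Gamma>" unfolding 2 J using prd_closed[OF Un W] .
    then show "is_join (compact_bisections G) (prd U W) (prd V W) (prd J W)"
      using is_join_Un[OF prd_closed[OF UV(1) W] prd_closed[OF UV(2) W]] 2 by metis
  qed
qed

end

(* The compact local bisections form a basis of the topology. Since compact open sets of units
   separate points, a bisection U commutes with all idempotents iff it consists of isotropy, so (1)
   and (3) compare the open subsets of the isotropy with the unit space. For (2), every orbit gives
   the additive ideal of bisections whose domain misses it; conversely, if all orbits are dense, the
   idempotents of a non-zero additive ideal cover the unit space, and by compactness the domain of
   any bisection is below a single idempotent of the ideal. *)

theory Submission
  imports Defs
begin

section \<open>Idempotents and open bisections in the etale case\<close>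

context etale_groupoid
begin

lemma openin_unit_top_iff: "openin (unit_top G) U \<longleftrightarrow> openin (gtop G) U \<and> U \<subseteq> units G"
  unfolding unit_top_def using openin_open_subtopology[OF openin_units] .

lemma compactin_unit_top_iff: "compactin (unit_top G) U \<longleftrightarrow> compactin (gtop G) U \<and> U \<subseteq> units G"
  unfolding unit_top_def by (rule compactin_subtopology)

lemma units_subset_isotropy: "units G \<subseteq> isotropy G"
  by (auto simp: isotropy_def unit_iff) (metis rng_dom)

text \<open>Domain and range maps are both the identity on units, so a set of units satisfies the
  injectivity conditions of a bisection automatically.\<close>

lemma idempotents_iff:
  "E \<in> idempotents (compact_bisections G) \<longleftrightarrow> openin (unit_top G) E \<and> compactin (unit_top G) E"
proof -
  have "inj_on (gdom G) E \<and> inj_on (grng G) E" if "E \<subseteq> units G"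
    using that unit_iff unit_iff_rng by (metis inj_onI subsetD)
  then show ?thesis
    by (auto simp: idem_iff Gamma_iff openin_unit_top_iff compactin_unit_top_iff)
qed

text \<open>The domain image of \<open>U\<close> is the product of the star of \<open>U\<close> with
  \<open>U\<close>.\<close>

lemma dom_image_idempotent: "U \<in> \<Gamma> \<Longrightarrow> gdom G ` U \<in> idempotents (compact_bisections G)"
  using prd_star_self[of U] prd_closed star_closed_Gamma dom_image_units idem_iff by metis

lemma idempotents_Un:
  assumes "E \<in> idempotents (compact_bisections G)" "F \<in> idempotents (compact_bisections G)"
  shows "E \<union> F \<in> idempotents (compact_bisections G)"
  using assms by (simp add: idempotents_iff openin_Un compactin_Un)

text \<open>The unit space is Hausdorff, so \<open>F\<close> is closed as well as open. Hence
  \<open>E - F\<close> is open, and it is compact as a closed subset of \<open>E\<close>.\<close>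

lemma idempotents_Diff:
  assumes "E \<in> idempotents (compact_bisections G)" "F \<in> idempotents (compact_bisections G)"
  shows "E - F \<in> idempotents (compact_bisections G)"
proof -
  have E: "openin (unit_top G) E" "compactin (unit_top G) E"
    and F: "openin (unit_top G) F" "closedin (unit_top G) F"
    using assms units_Hausdorff compactin_imp_closedin by (auto simp: idempotents_iff)
  have "closedin (unit_top G) (E - F)"
    using E F units_Hausdorff compactin_imp_closedin closedin_diff by blast
  then show ?thesis
    using E F openin_diff closed_compactin[OF E(2) Diff_subset] by (simp add: idempotents_iff)
qed

lemma ex_injective_neighbourhood:
  assumes "g \<in> arrows G"
  obtains U where "openin (gtop G) U" "g \<in> U" "inj_on (gdom G) U"
proof -
  obtain U where U: "openin (gtop G) U" "g \<in> U"
    "homeomorphic_map (subtopology (gtop G) U) (subtopology (unit_top G) (gdom G ` U)) (gdom G)"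
    using assms dom_local_homeomorphism unfolding local_homeomorphism_def arrows_def by meson
  then have "inj_on (gdom G) U"
    unfolding homeomorphic_map_def by (metis openin_subset topspace_subtopology_subset)
  then show ?thesis using that U by blast
qed

text \<open>The range of an arrow is the domain of its inverse. Injectivity of the range map near
  \<open>g\<close> is therefore obtained by inverting a neighbourhood of the inverse of
  \<open>g\<close> on which the domain map is injective.\<close>

lemma ex_open_bisection:
  assumes W: "openin (gtop G) W" and g: "g \<in> W"
  obtains U where "openin (gtop G) U" "g \<in> U" "U \<subseteq> W" "inj_on (gdom G) U" "inj_on (grng G) U"
proof -
  have gG: "g \<in> arrows G" using W g openin_subset by (auto simp: arrows_def)
  obtain A where A: "openin (gtop G) A" "g \<in> A" "inj_on (gdom G) A"
    using ex_injective_neighbourhood[OF gG] .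
  obtain B where B: "openin (gtop G) B" "ginv G g \<in> B" "inj_on (gdom G) B"
    using ex_injective_neighbourhood[OF inv_closed[OF gG]] .
  define U where "U = W \<inter> A \<inter> ginv G ` B"
  have oB: "openin (gtop G) (ginv G ` B)" using B(1) open_map_inv by (simp add: open_map_def)
  have BG: "B \<subseteq> arrows G" using B(1) openin_subset by (auto simp: arrows_def)
  have "inj_on (grng G) (ginv G ` B)"
    using B(3) BG rng_inv by (auto simp: inj_on_def subset_iff)
  then have "inj_on (gdom G) U" "inj_on (grng G) U"
    using A(3) unfolding U_def by (blast intro: inj_on_subset)+
  moreover have "g \<in> U" using g A(2) B(2) inv_inv[OF gG] unfolding U_def by (metis IntI imageI)
  moreover have "openin (gtop G) U" "U \<subseteq> W"
    using W A(1) oB unfolding U_def by (auto intro: openin_Int)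
  ultimately show ?thesis using that by blast
qed

end

section \<open>Bases of compact open sets\<close>

context ample_groupoid
begin

text \<open>The pointwise form of \<open>units_basis\<close>, through which ampleness enters all
  later arguments.\<close>

lemma idempotent_basis:
  assumes "openin (unit_top G) W" "x \<in> W"
  obtains E where "E \<in> idempotents (compact_bisections G)" "x \<in> E" "E \<subseteq> W"
proof -
  have "(arbitrary union_of (\<lambda>U. openin (unit_top G) U \<and> compactin (unit_top G) U)) W"
    using assms(1) units_basis by metis
  then show ?thesis
    using that assms(2) unfolding union_of_def arbitrary_def idempotents_iff by blast
qed

text \<open>An open bisection \<open>V\<close> around \<open>g\<close> is cut down to its part over
  a compact open set \<open>K\<close> of units inside its domain image. That part is open as a
  preimage, and compact because a continuous section carries \<open>K\<close> onto it.\<close>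

lemma compact_bisection_basis:
  assumes W: "openin (gtop G) W" and g: "g \<in> W"
  obtains U where "U \<in> \<Gamma>" "g \<in> U" "U \<subseteq> W"
proof -
  obtain V where O: "openin (gtop G) V" "g \<in> V" "V \<subseteq> W" "inj_on (gdom G) V" "inj_on (grng G) V"
    using ex_open_bisection[OF W g] .
  have "openin (unit_top G) (gdom G ` V)"
    using O(1) open_map_dom unfolding open_map_def by blast
  then obtain K where K: "K \<in> idempotents (compact_bisections G)" "gdom G g \<in> K" "K \<subseteq> gdom G ` V"
    using idempotent_basis O(2) by blast
  obtain s where s: "continuous_map (subtopology (unit_top G) (gdom G ` V)) (gtop G) s"
    "\<And>u. u \<in> V \<Longrightarrow> s (gdom G u) = u"
    using section_of_bisection[OF O(1,4) continuous_dom_units open_map_dom] by blast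
  define U where "U = {u \<in> V. gdom G u \<in> K}"
  have "U = V \<inter> {u \<in> topspace (gtop G). gdom G u \<in> K}"
    using openin_subset[OF O(1)] unfolding U_def by blast
  moreover have "openin (gtop G) {u \<in> topspace (gtop G). gdom G u \<in> K}"
    using K(1) openin_continuous_map_preimage[OF continuous_dom_units] by (simp add: idempotents_iff)
  ultimately have "openin (gtop G) U" using O(1) by (simp add: openin_Int)
  moreover have "U = s ` K"
  proof (intro equalityI subsetI)
    show "u \<in> s ` K" if "u \<in> U" for u
      using that s(2)[of u] unfolding U_def by (metis (mono_tags, lifting) imageI mem_Collect_eq)
    show "u \<in> U" if u: "u \<in> s ` K" for u
    proof -
      obtain v where "v \<in> V" "gdom G v \<in> K" "u = s (gdom G v)" using u K(3) by blast
      then show ?thesis using s(2) unfolding U_def by simp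
    qed
  qed
  moreover have "compactin (gtop G) (s ` K)"
    using K s(1) by (intro image_compactin[OF _ s(1)]) (simp add: compactin_subtopology idempotents_iff)
  moreover have "inj_on (gdom G) U" "inj_on (grng G) U"
    using O(4,5) unfolding U_def by (auto intro: inj_on_subset)
  ultimately have "U \<in> \<Gamma>" by (simp add: Gamma_iff)
  then show ?thesis using that K(2) O(2,3) unfolding U_def by blast
qed

section \<open>Isotropy and the centralizer of the idempotents\<close>

text \<open>Multiplying \<open>U\<close> by an idempotent on the right restricts its domain, on the
  left its range. The two restrictions agree on isotropy; conversely, an arrow with distinct domain
  and range is detected by an idempotent that separates these two units.\<close>

lemma idempotent_centralizer_iff:
  "U \<in> idempotent_centralizer (compact_bisections G) \<longleftrightarrow> U \<in> \<Gamma> \<and> U \<subseteq> isotropy G"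
proof (intro iffI conjI)
  assume U: "U \<in> \<Gamma> \<and> U \<subseteq> isotropy G"
  have "prd U E = prd E U" if E: "E \<in> idempotents (compact_bisections G)" for E
    using U E prd_unit_right[OF Gamma_subset] prd_unit_left[OF Gamma_subset]
    by (auto simp: idem_iff isotropy_def subset_iff)
  then show "U \<in> idempotent_centralizer (compact_bisections G)"
    using U unfolding idempotent_centralizer_def by blast
next
  assume U: "U \<in> idempotent_centralizer (compact_bisections G)"
  then show UG: "U \<in> \<Gamma>" unfolding idempotent_centralizer_def by blast
  show "U \<subseteq> isotropy G"
  proof
    fix u assume u: "u \<in> U"
    have uG: "u \<in> arrows G" using u UG Gamma_subset by blast
    have "gdom G u = grng G u"
    proof (rule ccontr)
      assume "gdom G u \<noteq> grng G u"
      then obtain A B where AB: "openin (unit_top G) A" "gdom G u \<in> A" "grng G u \<in> B" "A \<inter> B = {}"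
        using units_Hausdorff uG dom_units rng_units
        unfolding Hausdorff_space_def topspace_unit_top disjnt_def by metis
      obtain E where E: "E \<in> idempotents (compact_bisections G)" "gdom G u \<in> E" "E \<subseteq> A"
        using idempotent_basis[OF AB(1,2)] .
      have "prd U E = prd E U" using U E(1) unfolding idempotent_centralizer_def by blast
      moreover have "E \<subseteq> units G" using E(1) by (simp add: idem_iff)
      ultimately have "{v \<in> U. gdom G v \<in> E} = {v \<in> U. grng G v \<in> E}"
        using UG prd_unit_right[OF Gamma_subset] prd_unit_left[OF Gamma_subset] by metis
      \<comment> \<open>The arrow \<open>u\<close> lies in the left-hand set, but its range is in
        \<open>B\<close> and so outside \<open>E\<close>.\<close>
      then show False using u E(2,3) AB(3,4) by blast
    qed
    then show "u \<in> isotropy G" using uG by (simp add: isotropy_def)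
  qed
qed

text \<open>The centralizer consists of the compact bisections inside the isotropy. By the basis
  property these cover the interior of the isotropy, so both conditions say that this interior
  contains only units.\<close>

lemma effective_iff_fundamental: "effective G \<longleftrightarrow> fundamental (compact_bisections G)"
proof
  assume eff: "effective G"
  have "U \<subseteq> units G" if "U \<in> \<Gamma>" "U \<subseteq> isotropy G" for U
    using eff that interior_of_maximal Gamma_iff unfolding effective_def by metis
  then show "fundamental (compact_bisections G)"
    using units_subset_isotropy unfolding fundamental_def
    by (auto simp: set_eq_iff idempotent_centralizer_iff idem_iff)
next
  assume F: "fundamental (compact_bisections G)"
  have "g \<in> units G" if g: "g \<in> gtop G interior_of isotropy G" for g
  proof -
    obtain U where U: "U \<in> \<Gamma>" "g \<in> U" "U \<subseteq> gtop G interior_of isotropy G"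
      using compact_bisection_basis[OF openin_interior_of g] .
    then have "U \<in> idempotent_centralizer (compact_bisections G)"
      using subset_trans[OF U(3) interior_of_subset] by (simp add: idempotent_centralizer_iff)
    then have "U \<in> idempotents (compact_bisections G)" using F by (simp add: fundamental_def)
    then show ?thesis using U(2) idem_iff by blast
  qed
  then show "effective G"
    \<comment> \<open>The units form an open subset of the isotropy, so they always lie in its
      interior.\<close>
    using interior_of_maximal[OF units_subset_isotropy openin_units] unfolding effective_def by blast
qed

text \<open>The idempotents below \<open>U\<close> are the compact open sets of units contained in
  \<open>U\<close>. A non-zero one exists exactly when \<open>U\<close> meets the unit space, so the
  failure of quasi-fundamentality means a non-empty open set of isotropy without units.\<close>

lemma topologically_free_iff_quasi_fundamental:
  "topologically_free G \<longleftrightarrow> quasi_fundamental (compact_bisections G)"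
proof
  assume free: "topologically_free G"
  show "quasi_fundamental (compact_bisections G)"
    unfolding quasi_fundamental_def szero_def
  proof (intro ballI impI)
    fix U assume U: "U \<in> idempotent_centralizer (compact_bisections G)" "U \<noteq> {}"
    then have UG: "U \<in> \<Gamma>" "U \<subseteq> isotropy G" "openin (gtop G) U"
      by (auto simp: idempotent_centralizer_iff Gamma_iff)
    have "\<not> U \<subseteq> isotropy G - units G"
      using interior_of_maximal UG(3) free U(2) unfolding topologically_free_def by blast
    then obtain x where x: "x \<in> U \<inter> units G" using UG(2) by blast
    have "openin (unit_top G) (U \<inter> units G)"
      using UG(3) openin_units by (simp add: openin_unit_top_iff openin_Int)
    then obtain E where E: "E \<in> idempotents (compact_bisections G)" "x \<in> E" "E \<subseteq> U \<inter> units G"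
      using idempotent_basis x by blast
    then have "natural_le (compact_bisections G) E U"
      using UG(1) by (auto simp: natural_le_iff idem_iff)
    then show "\<exists>e \<in> idempotents (compact_bisections G).
        e \<noteq> {} \<and> natural_le (compact_bisections G) e U"
      using E by blast
  qed
next
  assume Q: "quasi_fundamental (compact_bisections G)"
  have False if g: "g \<in> gtop G interior_of (isotropy G - units G)" for g
  proof -
    obtain U where U: "U \<in> \<Gamma>" "g \<in> U" "U \<subseteq> gtop G interior_of (isotropy G - units G)"
      using compact_bisection_basis[OF openin_interior_of g] .
    then have U': "U \<subseteq> isotropy G - units G" using subset_trans[OF U(3) interior_of_subset] by simp
    then have "U \<in> idempotent_centralizer (compact_bisections G)"
      using U(1) idempotent_centralizer_iff by blast
    then obtain E where "E \<in> idempotents (compact_bisections G)" "E \<noteq> {}"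
        "natural_le (compact_bisections G) E U"
      using Q U(2) unfolding quasi_fundamental_def szero_def by blast
    then show False using U' unfolding natural_le_iff idem_iff by blast
  qed
  then show "topologically_free G" unfolding topologically_free_def by blast
qed

section \<open>Additive ideals and density of orbits\<close>

lemma ideal_dom_image:
  assumes I: "semigroup_ideal (compact_bisections G) I" and U: "U \<in> I"
  shows "gdom G ` U \<in> I"
proof -
  have "U \<in> \<Gamma>" using I U unfolding semigroup_ideal_def by blast
  then show ?thesis
    using I U star_closed_Gamma prd_star_self unfolding semigroup_ideal_def by metis
qed

text \<open>Additivity provides joins of orthogonal idempotents only. Replacing \<open>F\<close> by
  \<open>F - E\<close>, which is a multiple of \<open>F\<close> and hence in the ideal, makes the
  pair orthogonal without changing the union.\<close>

lemma additive_ideal_Un: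
  assumes I: "additive_ideal (compact_bisections G) I"
    and E: "E \<in> I" "E \<in> idempotents (compact_bisections G)"
    and F: "F \<in> I" "F \<in> idempotents (compact_bisections G)"
  shows "E \<union> F \<in> I"
proof -
  let ?D = "F - E"
  have D: "?D \<in> idempotents (compact_bisections G)" using idempotents_Diff E F by blast
  have un: "E \<subseteq> units G" "F \<subseteq> units G" "?D \<subseteq> units G" "E \<in> \<Gamma>" "F \<in> \<Gamma>" "?D \<in> \<Gamma>"
    using E F D by (auto simp: idem_iff)
  have "prd F ?D = ?D"
    using prd_unit_right[of F ?D] un by (auto simp: unit_iff subset_iff)
  then have DI: "?D \<in> I"
    using I F(1) un(6) unfolding additive_ideal_def semigroup_ideal_def by metis
  have "prd E ?D = {}"
    using prd_unit_right[of E ?D] un by (auto simp: unit_iff subset_iff)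
  then obtain J where J: "J \<in> I" "is_join (compact_bisections G) E ?D J"
    using I E D DI unfolding additive_ideal_def szero_def by blast
  have "E \<union> ?D \<in> \<Gamma>" using idempotents_Un[OF E(2) D] by (simp add: idem_iff)
  then have "J = E \<union> ?D" using is_join_Un un J(2) by blast
  then show ?thesis using J(1) by simp
qed

lemma additive_ideal_covers:
  assumes I: "additive_ideal (compact_bisections G) I" "{} \<in> I"
    and K: "compactin (unit_top G) K"
    and cover: "\<And>x. x \<in> K \<Longrightarrow> \<exists>E \<in> I. E \<in> idempotents (compact_bisections G) \<and> x \<in> E"
  shows "\<exists>E \<in> I. E \<in> idempotents (compact_bisections G) \<and> K \<subseteq> E"
proof -
  let ?C = "I \<inter> idempotents (compact_bisections G)"
  have "K \<subseteq> \<Union>?C" using cover by blast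
  moreover have "\<forall>E \<in> ?C. openin (unit_top G) E" by (simp add: idempotents_iff)
  ultimately obtain \<F> where \<F>: "finite \<F>" "\<F> \<subseteq> ?C" "K \<subseteq> \<Union>\<F>"
    using K unfolding compactin_def by meson
  from \<F>(1,2) have "\<Union>\<F> \<in> ?C"
  proof (induction \<F>)
    case empty
    \<comment> \<open>The empty subfamily can occur, when \<open>K\<close> is empty; its union is
      the zero of the ideal.\<close>
    then show ?case using I(2) by (simp add: idempotents_iff)
  next
    case (insert E \<F>)
    then show ?case using additive_ideal_Un[OF I(1)] idempotents_Un by simp
  qed
  then show ?thesis using \<F>(3) by blast
qed

text \<open>Multiplication by bisections moves a non-zero idempotent of the ideal along arrows.
  Density of the orbits lets these translates reach every unit, and compactness then bounds the
  domain of any bisection by one idempotent of the ideal.\<close>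

lemma minimal_imp_additively_0_simple:
  assumes min: "minimal_groupoid G" and ne: "arrows G \<noteq> {}"
  shows "additively_0_simple (compact_bisections G)"
  unfolding additively_0_simple_def szero_def
proof (intro conjI allI impI)
  obtain g where "g \<in> arrows G" using ne by blast
  then obtain U where "U \<in> \<Gamma>" "g \<in> U"
    using compact_bisection_basis[of "arrows G" g] by (metis arrows_def openin_topspace)
  then show "\<Gamma> \<noteq> {{}}" by blast
next
  fix I assume I: "additive_ideal (compact_bisections G) I"
  then have Is: "semigroup_ideal (compact_bisections G) I" by (simp add: additive_ideal_def)
  then have sub: "I \<subseteq> \<Gamma>" and ideal: "\<And>U V. U \<in> I \<Longrightarrow> V \<in> \<Gamma> \<Longrightarrow> prd U V \<in> I \<and> prd V U \<in> I"
    and "I \<noteq> {}"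
    unfolding semigroup_ideal_def by blast+
  have empty: "{} \<in> I"
  proof -
    obtain U where "U \<in> I" using \<open>I \<noteq> {}\<close> by blast
    moreover have "{} \<in> \<Gamma>" by (simp add: Gamma_iff)
    moreover have "prd U {} = {}" by (simp add: prd_def)
    ultimately show ?thesis using ideal by metis
  qed
  show "I = {{}} \<or> I = \<Gamma>"
  proof (rule disjCI)
    assume "I \<noteq> \<Gamma>"
    show "I = {{}}"
    proof (rule ccontr)
      assume "I \<noteq> {{}}"
      then obtain U where U: "U \<in> I" "U \<noteq> {}" using empty by blast
      let ?E = "gdom G ` U"
      have E: "?E \<in> I" "?E \<in> idempotents (compact_bisections G)"
        using ideal_dom_image[OF Is] dom_image_idempotent U sub by blast+
      have cover: "\<exists>F \<in> I. F \<in> idempotents (compact_bisections G) \<and> y \<in> F"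
        if y: "y \<in> units G" for y
      proof -
        have "unit_top G closure_of orbit G y = units G"
          using min y unfolding minimal_groupoid_def by blast
        moreover have "openin (unit_top G) ?E" "?E \<noteq> {}" "?E \<subseteq> units G"
          using E(2) U(2) by (auto simp: idempotents_iff openin_unit_top_iff)
        \<comment> \<open>The dense orbit of \<open>y\<close> meets the non-empty open set
          \<open>?E\<close>, which gives an arrow \<open>g\<close> from \<open>y\<close> into
          \<open>?E\<close>.\<close>
        ultimately obtain z where "z \<in> ?E" "z \<in> orbit G y"
          using openin_Int_closure_of_eq_empty[of "unit_top G" ?E "orbit G y"] by blast
        then obtain g where "g \<in> arrows G" "gdom G g = y" "z = grng G g"
          unfolding orbit_def by blast
        with \<open>z \<in> ?E\<close> have g: "g \<in> arrows G" "gdom G g = y" "grng G g \<in> ?E" by simp_all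
        obtain V where V: "V \<in> \<Gamma>" "g \<in> V"
          using compact_bisection_basis[of "arrows G" g] g(1) by (metis arrows_def openin_topspace)
        \<comment> \<open>This product lies in the ideal and contains \<open>g\<close>, so its
          domain image is an idempotent of the ideal containing \<open>y\<close>.\<close>
        have "prd ?E V \<in> I" using ideal E(1) V(1) by blast
        moreover have "g \<in> prd ?E V"
          using prd_unit_left[OF Gamma_subset[OF V(1)]] E(2) V(2) g(3) by (simp add: idem_iff)
        ultimately show ?thesis
          using g(2) ideal_dom_image[OF Is] dom_image_idempotent sub by blast
      qed
      have "V \<in> I" if V: "V \<in> \<Gamma>" for V
      proof -
        have "\<exists>F \<in> I. F \<in> idempotents (compact_bisections G) \<and> gdom G ` V \<subseteq> F"
        proof (rule additive_ideal_covers[OF I empty])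
          show "compactin (unit_top G) (gdom G ` V)"
            using dom_image_idempotent[OF V] by (simp add: idempotents_iff)
          show "\<exists>F \<in> I. F \<in> idempotents (compact_bisections G) \<and> y \<in> F" if "y \<in> gdom G ` V" for y
            using cover subsetD[OF dom_image_units[OF V] that] .
        qed
        then obtain F where F: "F \<in> I" "F \<in> idempotents (compact_bisections G)" "gdom G ` V \<subseteq> F"
          by blast
        then have "prd V F = V"
          using prd_unit_right[OF Gamma_subset[OF V]] by (auto simp: idem_iff)
        then show ?thesis using ideal F(1) V by metis
      qed
      then show False using sub \<open>I \<noteq> \<Gamma>\<close> by blast
    qed
  qed
qed

text \<open>An arrow \<open>h\<close> starting at \<open>x\<close> is extended by \<open>g\<close>
  in one direction and by the inverse of \<open>g\<close> in the other.\<close>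

lemma orbit_dom_iff_rng:
  assumes "g \<in> arrows G"
  shows "gdom G g \<in> orbit G x \<longleftrightarrow> grng G g \<in> orbit G x"
proof
  assume "gdom G g \<in> orbit G x"
  then obtain h where h: "h \<in> arrows G" "gdom G h = x" "gdom G g = grng G h"
    unfolding orbit_def by auto
  then have "(g, h) \<in> composable G" using assms by (simp add: composableI)
  then show "grng G g \<in> orbit G x"
    using h(2) unfolding orbit_def by (metis (mono_tags, lifting) mem_Collect_eq mult_closed dom_mult rng_mult)
next
  assume "grng G g \<in> orbit G x"
  then obtain h where h: "h \<in> arrows G" "gdom G h = x" "grng G g = grng G h"
    unfolding orbit_def by auto
  then have "(ginv G g, h) \<in> composable G" using assms by (simp add: composableI inv_closed dom_inv)
  then show "gdom G g \<in> orbit G x"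
    using h(2) rng_inv[OF assms] unfolding orbit_def
    by (metis (mono_tags, lifting) mem_Collect_eq mult_closed dom_mult rng_mult)
qed

text \<open>Invariance of the orbit makes this a two-sided ideal: along a product, the domains of
  both factors and of the result are all in the orbit or all outside it. Unions of idempotents
  preserve the condition, which gives additivity.\<close>

lemma additive_ideal_off_orbit:
  "additive_ideal (compact_bisections G) {U \<in> \<Gamma>. gdom G ` U \<inter> orbit G x = {}}"
  (is "additive_ideal _ ?I")
  unfolding additive_ideal_def semigroup_ideal_def
proof (intro conjI ballI impI)
  have "{} \<in> ?I" by (simp add: Gamma_iff)
  then show "?I \<noteq> {}" by blast
next
  have off: "prd U V \<in> ?I" if U: "U \<in> \<Gamma>" and V: "V \<in> \<Gamma>" and UV: "U \<in> ?I \<or> V \<in> ?I" for U V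
  proof -
    have "gdom G g \<notin> orbit G x" if g: "g \<in> prd U V" for g
    proof -
      obtain u v where uv: "g = gmult G u v" "u \<in> U" "v \<in> V" "gdom G u = grng G v"
        using g unfolding prd_def by blast
      have a: "u \<in> arrows G" "v \<in> arrows G" using uv U V Gamma_subset by blast+
      have "gdom G u \<notin> orbit G x \<or> gdom G v \<notin> orbit G x" using UV uv(2,3) by blast
      then show ?thesis
        \<comment> \<open>The domain of \<open>u\<close> is the range of \<open>v\<close>, so by
          invariance each of the two alternatives puts the domain of \<open>v\<close>, which is that
          of \<open>g\<close>, off the orbit.\<close>
        using uv a orbit_dom_iff_rng[OF a(2)] by (simp add: composableI dom_mult)
    qed
    then show ?thesis using prd_closed[OF U V] by blast
  qed
  fix S U assume "S \<in> \<Gamma>" "U \<in> ?I"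
  then show "prd S U \<in> ?I" "prd U S \<in> ?I" using off by blast+
next
  fix E F
  assume E: "E \<in> ?I \<inter> idempotents (compact_bisections G)"
    and F: "F \<in> ?I \<inter> idempotents (compact_bisections G)"
  then have "E \<union> F \<in> \<Gamma>" using idempotents_Un[of E F] by (simp add: idem_iff)
  then show "\<exists>J \<in> ?I. is_join (compact_bisections G) E F J"
    using E F is_join_Un[of E F] by (intro bexI[of _ "E \<union> F"]) auto
qed blast

text \<open>The ideal of bisections whose domain misses the orbit of \<open>x\<close> is proper,
  because a compact open neighbourhood of \<open>x\<close> is not in it. By simplicity it is zero,
  so every non-empty compact open set of units meets the orbit.\<close>

lemma additively_0_simple_imp_minimal:
  assumes "additively_0_simple (compact_bisections G)"
  shows "minimal_groupoid G"
  unfolding minimal_groupoid_def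
proof (intro ballI equalityI subsetI)
  fix x y assume x: "x \<in> units G"
  show "y \<in> units G" if "y \<in> unit_top G closure_of orbit G x"
    using subsetD[OF closure_of_subset_topspace that] by (simp add: topspace_unit_top)
  assume y: "y \<in> units G"
  let ?I = "{U \<in> \<Gamma>. gdom G ` U \<inter> orbit G x = {}}"
  obtain E where E: "E \<in> idempotents (compact_bisections G)" "x \<in> E"
    using idempotent_basis[of "units G" x] x topspace_unit_top openin_topspace by metis
  have dx: "gdom G x = x" "grng G x = x" "x \<in> arrows G" using x unit_iff unit_iff_rng by blast+
  then have "x \<in> orbit G x" unfolding orbit_def by force
  then have "E \<notin> ?I" using E(2) dx(1) by force
  then have "?I \<noteq> \<Gamma>" using E(1) idem_iff by blast
  then have I: "?I = {{}}"
    using assms additive_ideal_off_orbit unfolding additively_0_simple_def szero_def by blast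
  have "\<exists>z \<in> orbit G x. z \<in> T" if T: "y \<in> T" "openin (unit_top G) T" for T
  proof -
    obtain F where F: "F \<in> idempotents (compact_bisections G)" "y \<in> F" "F \<subseteq> T"
      using idempotent_basis[OF T(2,1)] .
    then have FG: "F \<in> \<Gamma>" "F \<subseteq> units G" by (auto simp: idem_iff)
    have "F \<notin> ?I" using I F(2) by blast
    then obtain z where "z \<in> F" "gdom G z \<in> orbit G x" using FG(1) by blast
    then show ?thesis using F(3) FG(2) unit_iff by (metis subsetD)
  qed
  then show "y \<in> unit_top G closure_of orbit G x"
    using y unfolding in_closure_of topspace_unit_top by blast
qed

end

theorem proposition2p10:
  fixes G :: "'a topological_groupoid_data"
  assumes "ample_groupoid G" and "arrows G \<noteq> {}"
  shows "(effective G \<longleftrightarrow> fundamental (compact_bisections G)) \<and>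
         (minimal_groupoid G \<longleftrightarrow> additively_0_simple (compact_bisections G)) \<and>
         (topologically_free G \<longleftrightarrow> quasi_fundamental (compact_bisections G))"
proof -
  interpret ample_groupoid G by (rule assms(1))
  show ?thesis
    using effective_iff_fundamental topologically_free_iff_quasi_fundamental
      minimal_imp_additively_0_simple[OF _ assms(2)] additively_0_simple_imp_minimal
    by blast
qed

end
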